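(* Let $G=(V,E)$ be a finite digraph, $n\ge 1$, $S=\{1,\dots,n\}$, and let $l_1,\dots,l_n$ be integers with $l_i\ge 1$. Let $P$ be the product poset $[0,l_1]\times\cdots\times[0,l_n]$ of integer intervals, with $(x_1,\dots,x_n)\le(y_1,\dots,y_n)$ iff $x_i\le y_i$ for all $i$. Then there exists a map $d:E\to S$ such that, for every $i$, no walk of length $l_i+1$ has all of its edges colored $i$ by $d$, if and only if the vertices of $G$ are $P$-colorable.
   Context: A digraph has finite vertex set and edges that are ordered pairs of distinct vertices; write $u\to v$ for an edge. A walk of length $L$ is a sequence $(v_1\dots v_{L+1})$ with $v_1\to\dots\to v_{L+1}$; its edges are $(v_j,v_{j+1})$. A $P$-coloring of the vertices is a map $c:V\to P$ with $c(u)\not\le c(v)$ whenever $u\to v$. *)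

theory Defs
  imports "Graph_Theory.Graph_Theory" "HOL-Library.FuncSet"
begin

(* Points of the product are extensional functions, so each tuple (x_1, ..., x_n)
   has exactly one representative. *)
definition interval_product :: "nat \<Rightarrow> (nat \<Rightarrow> int) \<Rightarrow> (nat \<Rightarrow> int) set" where
  "interval_product n l = (\<Pi>\<^sub>E i\<in>{1..n}. {0..l i})"

definition product_le :: "nat \<Rightarrow> (nat \<Rightarrow> int) \<Rightarrow> (nat \<Rightarrow> int) \<Rightarrow> bool" where
  "product_le n x y \<longleftrightarrow> (\<forall>i\<in>{1..n}. x i \<le> y i)"

definition poset_coloring ::
    "'p set \<Rightarrow> ('p \<Rightarrow> 'p \<Rightarrow> bool) \<Rightarrow> 'a pair_pre_digraph \<Rightarrow> ('a \<Rightarrow> 'p) \<Rightarrow> bool" where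
  "poset_coloring P le G c \<longleftrightarrow>
     c \<in> pverts G \<rightarrow> P \<and> (\<forall>(u, v)\<in>parcs G. \<not> le (c u) (c v))"

definition poset_colorable ::
    "'p set \<Rightarrow> ('p \<Rightarrow> 'p \<Rightarrow> bool) \<Rightarrow> 'a pair_pre_digraph \<Rightarrow> bool" where
  "poset_colorable P le G \<longleftrightarrow> (\<exists>c. poset_coloring P le G c)"

end

theory Submission
  imports Defs
begin

text \<open>
  A set \<open>A\<close> of arcs carries no walk of length \<open>k\<close> exactly when some height function with values
  below \<open>k\<close> strictly decreases along every arc of \<open>A\<close>; one such function is the maximal length
  of an \<open>A\<close>-walk starting at the given vertex. The coordinates of a \<open>P\<close>-coloring are such height
  functions, one for each colour class: \<open>c u \<le> c v\<close> fails iff some coordinate decreases from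
  \<open>u\<close> to \<open>v\<close>, and that coordinate is the colour of the arc \<open>(u, v)\<close>.
\<close>

text \<open>Each arc of the walk lowers \<open>h\<close> by at least one, and \<open>h\<close>
  cannot fall below 0, so the starting height pays for the whole length.\<close>

lemma vwalk_length_le_height:
  fixes h :: "'a \<Rightarrow> nat"
  assumes "vwalk p G" and "set (vwalk_arcs p) \<subseteq> A"
    and "\<And>u v. (u, v) \<in> arcs_ends G \<inter> A \<Longrightarrow> h v < h u"
  shows "vwalk_length p \<le> h (hd p)"
  using assms(1,2)
proof (induction p rule: vwalk_induct)
  case (Cons u v es)
  then have "h v < h u" and "vwalk_length (v # es) \<le> h v"
    using assms(3)[of u v] by auto
  then show ?case by simp
qed simp

text \<open>Truncation turns the absence of walks of length exactly \<open>k\<close> into a bound on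
  the length of every walk, since the prefix stays inside the same arc set.\<close>

lemma vwalk_prefix:
  assumes "vwalk p G" and "k \<le> vwalk_length p"
  obtains q where "vwalk q G" and "vwalk_length q = k" and "set (vwalk_arcs q) \<subseteq> set (vwalk_arcs p)"
proof
  let ?q = "take (Suc k) p"
  have "p \<noteq> []" using assms(1) by auto
  then have "?q \<noteq> []" by simp
  show "vwalk ?q G"
    using assms(1) \<open>?q \<noteq> []\<close> vwalkI_append_l[of ?q "drop (Suc k) p" G] by simp
  show "vwalk_length ?q = k" using \<open>p \<noteq> []\<close> assms(2) by (cases p) auto
  show "set (vwalk_arcs ?q) \<subseteq> set (vwalk_arcs p)"
    using set_vwalk_arcs_append1[of ?q "drop (Suc k) p"] by simp
qed

lemma (in pair_wf_digraph) no_vwalk_iff_height: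
  "(\<nexists>p. vwalk p (with_proj G) \<and> vwalk_length p = k \<and> set (vwalk_arcs p) \<subseteq> A) \<longleftrightarrow>
   (\<exists>h :: 'a \<Rightarrow> nat. (\<forall>v\<in>pverts G. h v < k) \<and> (\<forall>(u, v)\<in>parcs G \<inter> A. h v < h u))"
  (is "?L \<longleftrightarrow> ?R")
proof
  assume L: ?L
  define W where "W v = {p. vwalk p (with_proj G) \<and> hd p = v \<and> set (vwalk_arcs p) \<subseteq> A}" for v
  define h where "h v = Max (vwalk_length ` W v)" for v
  have short: "vwalk_length p < k" if "p \<in> W v" for p v
  proof (rule ccontr)
    assume "\<not> vwalk_length p < k"
    then have "k \<le> vwalk_length p" by simp
    moreover have "vwalk p (with_proj G)" and "set (vwalk_arcs p) \<subseteq> A"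
      using that by (simp_all add: W_def)
    ultimately show False using vwalk_prefix L by (metis subset_trans)
  qed
  \<comment> \<open>Walks may revisit vertices, so \<open>W v\<close> itself can be infinite; only
    the set of lengths is finite, thanks to the bound \<open>k\<close>.\<close>
  have fin: "finite (vwalk_length ` W v)" for v
    by (rule finite_subset[of _ "{..<k}"]) (use short in auto)
  have attained: "\<exists>p\<in>W v. h v = vwalk_length p" if "v \<in> pverts G" for v
  proof -
    \<comment> \<open>The trivial walk of length 0 makes the maximum range over a nonempty set, so
      that it is attained.\<close>
    have "[v] \<in> W v" using that by (simp add: W_def)
    then have "vwalk_length ` W v \<noteq> {}" by blast
    from Max_in[OF fin this] show ?thesis unfolding h_def by blast
  qed
  have "h v < h u" if uv: "(u, v) \<in> parcs G" "(u, v) \<in> A" for u v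
  proof -
    have "u \<in> pverts G" "v \<in> pverts G"
      using uv(1) in_arcsD1 in_arcsD2 by auto
    then obtain p where p: "p \<in> W v" "h v = vwalk_length p" using attained by blast
    have "p \<noteq> []" using p(1) by (auto simp: W_def)
    \<comment> \<open>Prepending \<open>u\<close> to a longest walk from \<open>v\<close> gives a
      walk from \<open>u\<close> that is longer by one.\<close>
    have "u # p \<in> W u"
      using p(1) uv \<open>u \<in> pverts G\<close> \<open>p \<noteq> []\<close> by (auto simp: W_def intro: vwalk_consI)
    then have "vwalk_length (u # p) \<le> h u" unfolding h_def by (intro Max_ge fin imageI)
    then show ?thesis using p(2) \<open>p \<noteq> []\<close> by (cases p) auto
  qed
  moreover have "h v < k" if "v \<in> pverts G" for v
    using attained[OF that] short by auto
  ultimately show ?R by blast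
next
  assume ?R
  then obtain h :: "'a \<Rightarrow> nat" where below: "\<And>v. v \<in> pverts G \<Longrightarrow> h v < k"
    and dec: "\<And>u v. (u, v) \<in> parcs G \<inter> A \<Longrightarrow> h v < h u" by blast
  show ?L
  proof
    assume "\<exists>p. vwalk p (with_proj G) \<and> vwalk_length p = k \<and> set (vwalk_arcs p) \<subseteq> A"
    then obtain p where p: "vwalk p (with_proj G)" "vwalk_length p = k" "set (vwalk_arcs p) \<subseteq> A"
      by blast
    then have "k \<le> h (hd p)"
      using vwalk_length_le_height[of p "with_proj G" A h] dec by simp
    moreover have "hd p \<in> pverts G" using p(1) by (auto simp: vwalk_def)
    ultimately show False using below by fastforce
  qed
qed

theorem mainTheorem4:
  fixes G :: "'a pair_pre_digraph" and n :: nat and l :: "nat \<Rightarrow> int"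
  assumes "pair_digraph G"
    and "n \<ge> 1"
    and "\<And>i. i \<in> {1..n} \<Longrightarrow> l i \<ge> 1"
  shows "(\<exists>d \<in> parcs G \<rightarrow> {1..n}. \<forall>i\<in>{1..n}.
            \<not> (\<exists>p. vwalk p (with_proj G) \<and> int (vwalk_length p) = l i + 1 \<and>
                   (\<forall>e\<in>set (vwalk_arcs p). d e = i)))
         \<longleftrightarrow> poset_colorable (interval_product n l) (product_le n) G"
proof -
  interpret pair_digraph G by fact
  \<comment> \<open>This is the height criterion with \<open>k = nat (l i + 1)\<close>: naturals
    below that bound are exactly the values in the interval from 0 to \<open>l i\<close>, the range
    of coordinate \<open>i\<close>.\<close>
  have height: "\<not> (\<exists>p. vwalk p (with_proj G) \<and> int (vwalk_length p) = l i + 1 \<and>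
        (\<forall>e\<in>set (vwalk_arcs p). d e = i)) \<longleftrightarrow>
      (\<exists>h :: 'a \<Rightarrow> nat. (\<forall>v\<in>pverts G. int (h v) \<le> l i) \<and>
        (\<forall>(u, v)\<in>parcs G. d (u, v) = i \<longrightarrow> h v < h u))"
    if "i \<in> {1..n}" for d :: "'a \<times> 'a \<Rightarrow> nat" and i
  proof -
    have "int m = l i + 1 \<longleftrightarrow> m = nat (l i + 1)" "int m \<le> l i \<longleftrightarrow> m < nat (l i + 1)" for m
      using assms(3)[OF that] by auto
    moreover have "(\<forall>e\<in>S. d e = i) \<longleftrightarrow> S \<subseteq> {e. d e = i}" for S by blast
    moreover have "(\<forall>(u, v)\<in>parcs G. d (u, v) = i \<longrightarrow> h v < h u) \<longleftrightarrow>
        (\<forall>(u, v)\<in>parcs G \<inter> {e. d e = i}. h v < h u)" for h :: "'a \<Rightarrow> nat" by auto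
    ultimately show ?thesis
      using no_vwalk_iff_height[of "nat (l i + 1)" "{e. d e = i}"] by (simp only:)
  qed
  show ?thesis (is "?L \<longleftrightarrow> ?R")
  proof
    assume ?L
    then obtain d where d: "d \<in> parcs G \<rightarrow> {1..n}" and
      "\<forall>i\<in>{1..n}. \<exists>h :: 'a \<Rightarrow> nat. (\<forall>v\<in>pverts G. int (h v) \<le> l i) \<and>
        (\<forall>(u, v)\<in>parcs G. d (u, v) = i \<longrightarrow> h v < h u)"
      using height by blast
    from bchoice[OF this(2)] obtain h :: "nat \<Rightarrow> 'a \<Rightarrow> nat" where
      h: "\<And>i v. i \<in> {1..n} \<Longrightarrow> v \<in> pverts G \<Longrightarrow> int (h i v) \<le> l i"
        "\<And>i u v. i \<in> {1..n} \<Longrightarrow> (u, v) \<in> parcs G \<Longrightarrow> d (u, v) = i \<Longrightarrow> h i v < h i u"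
      by blast
    \<comment> \<open>Coordinate \<open>i\<close> is the height for colour class \<open>i\<close>;
      restricting the function to \<open>{1..n}\<close> makes it extensional, as membership in
      \<open>interval_product\<close> demands.\<close>
    have "poset_coloring (interval_product n l) (product_le n) G (\<lambda>v. \<lambda>i\<in>{1..n}. int (h i v))"
      unfolding poset_coloring_def
    proof (intro conjI ballI, safe)
      fix v assume "v \<in> pverts G"
      then show "(\<lambda>i\<in>{1..n}. int (h i v)) \<in> interval_product n l"
        using h(1) by (auto simp: interval_product_def)
    next
      fix u v
      assume uv: "(u, v) \<in> parcs G"
        and le: "product_le n (\<lambda>i\<in>{1..n}. int (h i u)) (\<lambda>i\<in>{1..n}. int (h i v))"
      have i: "d (u, v) \<in> {1..n}" using d uv by blast
      with le have "h (d (u, v)) u \<le> h (d (u, v)) v" by (auto simp: product_le_def)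
      with h(2)[OF i uv refl] show False by simp
    qed
    then show ?R unfolding poset_colorable_def by blast
  next
    assume ?R
    then obtain c where c: "\<And>v. v \<in> pverts G \<Longrightarrow> c v \<in> interval_product n l"
      "\<And>u v. (u, v) \<in> parcs G \<Longrightarrow> \<not> product_le n (c u) (c v)"
      unfolding poset_colorable_def poset_coloring_def by blast
    \<comment> \<open>Coordinates are linearly ordered, so failure of the product order means a
      strict drop in some coordinate; any such coordinate may serve as the colour.\<close>
    have "\<forall>e\<in>parcs G. \<exists>i. i \<in> {1..n} \<and> c (snd e) i < c (fst e) i"
      using c(2) by (force simp: product_le_def not_le)
    then obtain d where d: "\<And>e. e \<in> parcs G \<Longrightarrow> d e \<in> {1..n}"
      "\<And>e. e \<in> parcs G \<Longrightarrow> c (snd e) (d e) < c (fst e) (d e)"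
      by (auto dest!: bchoice)
    have range: "0 \<le> c v i \<and> c v i \<le> l i" if "v \<in> pverts G" "i \<in> {1..n}" for v i
      using c(1)[OF that(1)] that(2) by (auto simp: interval_product_def dest: PiE_mem)
    have "\<exists>h :: 'a \<Rightarrow> nat. (\<forall>v\<in>pverts G. int (h v) \<le> l i) \<and>
        (\<forall>(u, v)\<in>parcs G. d (u, v) = i \<longrightarrow> h v < h u)" if i: "i \<in> {1..n}" for i
    \<comment> \<open>Coordinate \<open>i\<close> of the given coloring is the height; its values
      are nonnegative on vertices, so \<open>nat\<close> preserves both the bound and strict
      decrease.\<close>
    proof (intro exI[of _ "\<lambda>v. nat (c v i)"] conjI ballI, goal_cases)
      case (1 v)
      then show ?case using range[OF _ i] by simp
    next
      case (2 e)
      have "fst e \<in> pverts G" "snd e \<in> pverts G"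
        using 2 in_arcsD1 in_arcsD2 by (cases e; auto)+
      then show ?case
        using range[OF _ i] d(2)[OF 2] by (auto simp: split_beta zless_nat_conj) (smt (verit))
    qed
    then have "\<forall>i\<in>{1..n}. \<not> (\<exists>p. vwalk p (with_proj G) \<and> int (vwalk_length p) = l i + 1 \<and>
        (\<forall>e\<in>set (vwalk_arcs p). d e = i))"
      using height by blast
    then show ?L using d(1) by (intro bexI[of _ d]) auto
  qed
qed

end
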